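(* Let $G$ be a finite abelian group of order $n$. For every positive integer $m$, $$|\mathsf M(G,m)|=|m\mathcal P_G\cap\mathbb Z^n|.$$ Moreover, if $A\subseteq G$ is nonempty and $F_A:=T(\Delta_A)$, then $F_A$ is a face of $\mathcal P_G$ of dimension $|A|-1$, and $$|mF_A^\circ\cap\mathbb Z^n|=|m\Delta_A^\circ\cap\Lambda_G|=|\{S\in\mathsf M(G,m):\operatorname{supp}(S)=A\}|.$$ In particular, $$|m\mathcal P_G^\circ\cap\mathbb Z^n|=|\{S\in\mathsf M(G,m):\operatorname{supp}(S)=G\}|.$$
   Context: $G$ is written additively. A sequence over $G$ is a finite unordered sequence of elements of $G$ with repetitions allowed (a multiplicity vector $(a_g)\in\mathbb Z_{\ge0}^G$); its length is $\sum_g a_g$, its sum is $\sum_g a_g g$, its support is $\operatorname{supp}(S)=\{g:a_g>0\}$; it is zero-sum if its sum is $0$. $\mathsf M(G,m)$ is the set of zero-sum sequences of length $m$. $\Delta_G=\{x=(x_g)_{g\in G}\in\mathbb R_{\ge0}^G:\sum_g x_g=1\}$; for $x\in\Delta_G$, $\operatorname{supp}(x)=\{g:x_g>0\}$. For nonempty $A\subseteq G$, $\Delta_A=\{x\in\Delta_G:\operatorname{supp}(x)\subseteq A\}$ and $\Delta_A^\circ=\{x\in\Delta_G:\operatorname{supp}(x)=A\}$. $\Lambda_G=\{(a_g)\in\mathbb Z^G:\sum_g a_g g=0\text{ in }G\}$, a full-rank sublattice of $\mathbb Z^G$. $T:\mathbb R^G\to\mathbb R^n$ is the linear isomorphism sending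 a chosen $\mathbb Z$-basis of $\Lambda_G$ to the standard basis of $\mathbb Z^n$, so $T(\Lambda_G)=\mathbb Z^n$, and $\mathcal P_G=T(\Delta_G)$. For a face $F$ of a polytope, $F^\circ$ is its relative interior. *)

theory Defs
  imports "HOL-Analysis.Analysis" "HOL-Library.Multiset"
begin

text \<open>
  The group is the universe of a type of class \<open>finite\<close> and \<open>ab_group_add\<close>; real
  vectors indexed by it have type \<open>real ^ 'g\<close>. A sequence over the group is a multiset.
\<close>

definition zero_sum_seqs :: "nat \<Rightarrow> 'g::{finite,ab_group_add} multiset set" where
  "zero_sum_seqs m = {S. size S = m \<and> sum_mset S = 0}"

definition std_simplex :: "(real ^ 'g::finite) set" where
  "std_simplex = {x. (\<forall>g. 0 \<le> x $ g) \<and> (\<Sum>g\<in>UNIV. x $ g) = 1}"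

definition vec_supp :: "real ^ 'g::finite \<Rightarrow> 'g set" where
  "vec_supp x = {g. 0 < x $ g}"

definition simplex_face :: "'g::finite set \<Rightarrow> (real ^ 'g) set" where
  "simplex_face A = {x \<in> std_simplex. vec_supp x \<subseteq> A}"

definition open_simplex_face :: "'g::finite set \<Rightarrow> (real ^ 'g) set" where
  "open_simplex_face A = {x \<in> std_simplex. vec_supp x = A}"

text \<open>The integer multiple of a group element; at most one of the two sums is nonempty.\<close>

definition zsmult :: "int \<Rightarrow> 'g::ab_group_add \<Rightarrow> 'g" where
  "zsmult k g = (\<Sum>i<nat k. g) - (\<Sum>i<nat (- k). g)"

definition relation_lattice :: "(real ^ 'g::{finite,ab_group_add}) set" where
  "relation_lattice =
     {(\<chi> g. of_int (a g)) | a. (\<Sum>g\<in>UNIV. zsmult (a g) g) = 0}"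

definition integer_points :: "(real ^ 'n::finite) set" where
  "integer_points = {x. \<forall>i. x $ i \<in> \<int>}"

definition is_Z_basis :: "('i::finite \<Rightarrow> 'v::real_vector) \<Rightarrow> 'v set \<Rightarrow> bool" where
  "is_Z_basis b L \<longleftrightarrow> range b \<subseteq> L \<and>
     (\<forall>x\<in>L. \<exists>!c :: 'i \<Rightarrow> int. x = (\<Sum>i\<in>UNIV. of_int (c i) *\<^sub>R b i))"

definition dilate :: "nat \<Rightarrow> 'v::real_vector set \<Rightarrow> 'v set" where
  "dilate m X = (\<lambda>x. real m *\<^sub>R x) ` X"

text \<open>
  The sets that are counted are finite, so that \<open>card\<close> is the true cardinality. The set
  \<open>Y\<close> below covers the polytope and the relative interiors of its faces.
\<close>

lemma finite_zero_sum_seqs: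
  "finite (zero_sum_seqs m :: 'g::{finite,ab_group_add} multiset set)"
proof -
  have "zero_sum_seqs m \<subseteq> mset ` {xs. set xs \<subseteq> (UNIV :: 'g set) \<and> length xs = m}"
  proof
    fix S :: "'g multiset" assume S: "S \<in> zero_sum_seqs m"
    obtain xs where "S = mset xs" by (metis ex_mset)
    with S show "S \<in> mset ` {xs. set xs \<subseteq> UNIV \<and> length xs = m}"
      by (auto simp: zero_sum_seqs_def)
  qed
  then show ?thesis
    by (rule finite_subset) (intro finite_imageI finite_lists_length_eq finite)
qed

lemma finite_bounded_integer_points:
  fixes X :: "(real ^ 'n::finite) set"
  assumes "bounded X"
  shows "finite (X \<inter> integer_points)"
proof -
  obtain B where B: "\<And>x. x \<in> X \<Longrightarrow> norm x \<le> B"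
    using assms by (auto simp: bounded_iff)
  let ?S = "real_of_int ` {\<lfloor>- B\<rfloor>..\<lceil>B\<rceil>}"
  have "X \<inter> integer_points \<subseteq> vec_lambda ` (UNIV \<rightarrow>\<^sub>E ?S)"
  proof
    fix x assume x: "x \<in> X \<inter> integer_points"
    have "x $ i \<in> ?S" for i
    proof -
      obtain k where k: "x $ i = of_int k"
        using x by (auto simp: integer_points_def elim: Ints_cases)
      have "\<bar>x $ i\<bar> \<le> B" using B x component_le_norm_cart[of x i] by fastforce
      then have "k \<in> {\<lfloor>- B\<rfloor>..\<lceil>B\<rceil>}" using k by (auto; linarith)
      then show ?thesis using k by blast
    qed
    then have "vec_nth x \<in> (UNIV \<rightarrow>\<^sub>E ?S)" by auto
    then show "x \<in> vec_lambda ` (UNIV \<rightarrow>\<^sub>E ?S)"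
      by (metis image_eqI vec_nth_inverse)
  qed
  moreover have "finite (vec_lambda ` (UNIV \<rightarrow>\<^sub>E ?S) :: (real ^ 'n) set)"
    by (intro finite_imageI finite_PiE) auto
  ultimately show ?thesis by (rule finite_subset)
qed

lemma bounded_std_simplex: "bounded (std_simplex :: (real ^ 'g::finite) set)"
proof -
  have "norm x \<le> 1" if "x \<in> std_simplex" for x :: "real ^ 'g"
    using norm_le_l1_cart[of x] that by (simp add: std_simplex_def)
  then show ?thesis by (auto simp: bounded_iff)
qed

lemma bounded_dilate: "bounded X \<Longrightarrow> bounded (dilate m X)"
  for X :: "'v::real_normed_vector set"
  by (simp add: dilate_def bounded_scaling)

lemma finite_dilate_integer_points:
  fixes T :: "real ^ 'g::finite \<Rightarrow> real ^ 'n::finite"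
  assumes "linear T" and "Y \<subseteq> T ` std_simplex"
  shows "finite (dilate m Y \<inter> integer_points)"
  using assms
  by (meson bounded_std_simplex bounded_dilate bounded_linear_image bounded_subset
      finite_bounded_integer_points linear_conv_bounded_linear)

lemma finite_dilate_relation_lattice:
  "finite (dilate m (open_simplex_face A) \<inter> relation_lattice)"
proof -
  have "bounded (dilate m (open_simplex_face A))"
    by (rule bounded_dilate, rule bounded_subset[OF bounded_std_simplex])
       (auto simp: open_simplex_face_def)
  then have "finite (dilate m (open_simplex_face A) \<inter> integer_points)"
    by (rule finite_bounded_integer_points)
  moreover have "relation_lattice \<subseteq> integer_points"
    by (auto simp: relation_lattice_def integer_points_def)
  ultimately show ?thesis
    by (meson Int_mono finite_subset subset_refl)
qed

end

theory Submission
  imports Defs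
begin

text \<open>
  The map \<open>T\<close> is onto (its image contains the standard basis) and the dimensions agree, so it is injective; since it sends a basis of
  the relation lattice to the standard basis, lattice points of \<open>X\<close> correspond to integer
  points of \<open>T ` X\<close>. Lattice points of the dilated simplex are exactly the multiplicity
  vectors of zero-sum sequences, and the faces of the simplex are convex hulls of standard
  unit vectors, whose relative interiors are given by strictly positive weights.
\<close>

section \<open>Integer multiples, and closure of the relation lattice under integer
  combinations\<close>

lemma zsmult_0 [simp]: "zsmult 0 g = 0"
  by (simp add: zsmult_def)

lemma zsmult_of_nat: "zsmult (int k) g = (\<Sum>i<k. g)"
  by (simp add: zsmult_def)

text \<open>The only place where the sign of \<open>k\<close> is split: for \<open>k < 0\<close> the
  subtracted sum loses one term. Additivity then follows by two-sided induction from 0.\<close>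

lemma zsmult_add_one: "zsmult (k + 1) g = zsmult k g + g"
proof (cases "0 \<le> k")
  case True
  then show ?thesis by (simp add: zsmult_def nat_add_distrib)
next
  case False
  then have "nat (- k) = Suc (nat (- (k + 1)))" by simp
  then have "(\<Sum>i<nat (- k). g) = (\<Sum>i<nat (- (k + 1)). g) + g" by simp
  with False show ?thesis by (simp add: zsmult_def)
qed

lemma zsmult_add: "zsmult (j + k) g = zsmult j g + zsmult k g"
proof (induction k rule: int_induct [where k = 0])
  case base
  show ?case by simp
next
  case (step1 i)
  then show ?case using zsmult_add_one[of "j + i" g] zsmult_add_one[of i g]
    by (simp add: add.assoc)
next
  case (step2 i)
  then show ?case using zsmult_add_one[of "j + (i - 1)" g] zsmult_add_one[of "i - 1" g]
    by (simp add: algebra_simps)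
qed

lemma zsmult_minus: "zsmult (- k) g = - zsmult k g"
  by (simp add: zsmult_def)

lemma zero_mem_relation_lattice: "0 \<in> relation_lattice"
  unfolding relation_lattice_def
  by (rule CollectI, rule exI[of _ "\<lambda>_. 0"]) (simp add: vec_eq_iff)

lemma add_mem_relation_lattice:
  assumes "x \<in> relation_lattice" "y \<in> relation_lattice"
  shows "x + y \<in> relation_lattice"
proof -
  obtain a c where
    "x = (\<chi> g. of_int (a g))" "(\<Sum>g\<in>UNIV. zsmult (a g) g) = 0"
    "y = (\<chi> g. of_int (c g))" "(\<Sum>g\<in>UNIV. zsmult (c g) g) = 0"
    using assms by (auto simp: relation_lattice_def)
  then show ?thesis unfolding relation_lattice_def
    by (intro CollectI exI[of _ "\<lambda>g. a g + c g"])
       (simp add: vec_eq_iff zsmult_add sum.distrib)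
qed

lemma minus_mem_relation_lattice:
  assumes "x \<in> relation_lattice"
  shows "- x \<in> relation_lattice"
proof -
  obtain a where "x = (\<chi> g. of_int (a g))" "(\<Sum>g\<in>UNIV. zsmult (a g) g) = 0"
    using assms by (auto simp: relation_lattice_def)
  then show ?thesis unfolding relation_lattice_def
    by (intro CollectI exI[of _ "\<lambda>g. - a g"])
       (simp add: vec_eq_iff zsmult_minus sum_negf)
qed

text \<open>Integer scaling is repeated addition or subtraction. Together with closure under sums,
  this will put integer combinations of a basis into the lattice.\<close>

lemma scaleR_of_int_mem_relation_lattice:
  assumes "x \<in> relation_lattice"
  shows "of_int k *\<^sub>R x \<in> relation_lattice"
proof (induction k rule: int_induct [where k = 0])
  case base
  show ?case by (simp add: zero_mem_relation_lattice)
next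
  case (step1 i)
  then show ?case using add_mem_relation_lattice[OF _ assms] by (simp add: scaleR_left_distrib)
next
  case (step2 i)
  then show ?case
    using add_mem_relation_lattice[OF _ minus_mem_relation_lattice[OF assms]]
    by (force simp: scaleR_left_diff_distrib)
qed

lemma sum_mem_relation_lattice:
  assumes "\<And>i. i \<in> I \<Longrightarrow> f i \<in> relation_lattice"
  shows "sum f I \<in> relation_lattice"
  using assms
  by (induction I rule: infinite_finite_induct)
     (auto simp: zero_mem_relation_lattice intro: add_mem_relation_lattice)

section \<open>Zero-sum sequences as lattice points of dilated simplices\<close>

text \<open>Links the sum of a sequence to the condition defining the lattice. Adding an element
  \<open>x\<close> changes only the summand at \<open>g = x\<close>, by exactly
  \<open>x\<close>.\<close>

lemma sum_mset_eq_sum_zsmult: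
  "sum_mset S = (\<Sum>g\<in>UNIV. zsmult (int (count S g)) g)"
  for S :: "'g::{finite,ab_group_add} multiset"
proof (induction S)
  case empty
  show ?case by simp
next
  case (add x S)
  have "zsmult (int (count (add_mset x S) g)) g
      = zsmult (int (count S g)) g + (if g = x then x else 0)" for g
    by (auto simp: zsmult_of_nat)
  with add show ?case by (simp add: sum.distrib add.commute)
qed

lemma size_eq_sum_count_UNIV: "size S = (\<Sum>g\<in>UNIV. count S g)"
  for S :: "'g::finite multiset"
  unfolding size_multiset_overloaded_eq
  by (rule sum.mono_neutral_left) (auto simp: not_in_iff)

definition multiplicity_vec :: "'g::finite multiset \<Rightarrow> real ^ 'g" where
  "multiplicity_vec S = (\<chi> g. real (count S g))"

lemma inj_multiplicity_vec: "inj multiplicity_vec"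
  by (rule injI) (auto simp: multiplicity_vec_def vec_eq_iff multiset_eq_iff)

text \<open>The family \<C> of admissible supports lets one argument serve all counts:
  \<open>UNIV\<close> imposes no condition, \<open>{A}\<close> prescribes the support
  \<open>A\<close>. Since \<open>m > 0\<close>, scaling by \<open>m\<close> or \<open>1 / m\<close>
  preserves supports.\<close>

lemma multiplicity_vec_image:
  assumes "0 < m"
  shows "multiplicity_vec ` {S \<in> zero_sum_seqs m. set_mset S \<in> \<C>}
       = dilate m {x \<in> std_simplex. vec_supp x \<in> \<C>} \<inter> relation_lattice"
proof (intro equalityI subsetI)
  fix y assume "y \<in> multiplicity_vec ` {S \<in> zero_sum_seqs m. set_mset S \<in> \<C>}"
  then obtain S where y: "y = multiplicity_vec S" and size: "size S = m"
    and zero: "sum_mset S = 0" and supp: "set_mset S \<in> \<C>"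
    by (auto simp: zero_sum_seqs_def)
  let ?x = "(1 / real m) *\<^sub>R y"
  have "(\<Sum>g\<in>UNIV. real (count S g)) = real m"
    using size size_eq_sum_count_UNIV[of S] by (metis of_nat_sum)
  then have "?x \<in> std_simplex"
    using assms
    by (simp add: y std_simplex_def multiplicity_vec_def flip: sum_divide_distrib)
  moreover have "vec_supp ?x = set_mset S"
    using assms by (auto simp: vec_supp_def y multiplicity_vec_def zero_less_divide_iff)
  moreover have "y = real m *\<^sub>R ?x" using assms by simp
  ultimately have "y \<in> dilate m {x \<in> std_simplex. vec_supp x \<in> \<C>}"
    using supp unfolding dilate_def by (intro image_eqI[of _ _ ?x]) auto
  moreover have "y \<in> relation_lattice"
    unfolding relation_lattice_def using zero
    by (intro CollectI exI[of _ "\<lambda>g. int (count S g)"])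
       (simp add: y multiplicity_vec_def sum_mset_eq_sum_zsmult)
  ultimately show "y \<in> dilate m {x \<in> std_simplex. vec_supp x \<in> \<C>} \<inter> relation_lattice"
    by blast
next
  fix y assume "y \<in> dilate m {x \<in> std_simplex. vec_supp x \<in> \<C>} \<inter> relation_lattice"
  then obtain x where y: "y = real m *\<^sub>R x" and x: "x \<in> std_simplex" "vec_supp x \<in> \<C>"
    and "y \<in> relation_lattice"
    by (auto simp: dilate_def)
  then obtain a where a: "y = (\<chi> g. of_int (a g))" and zero: "(\<Sum>g\<in>UNIV. zsmult (a g) g) = 0"
    unfolding relation_lattice_def by blast
  \<comment> \<open>Compares the two descriptions of \<open>y\<close>, as a lattice point and as a
    point of the dilate. Sign, total and support of \<open>a\<close> are all read off from
    \<open>x\<close>.\<close>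
  have ax: "real_of_int (a g) = real m * x $ g" for g
    using y a by (metis vec_lambda_beta vector_scaleR_component real_scaleR_def)
  have nonneg: "0 \<le> a g" for g
  proof -
    have "0 \<le> real_of_int (a g)" unfolding ax using x by (simp add: std_simplex_def)
    then show ?thesis by simp
  qed
  \<comment> \<open>The preimage of \<open>y\<close>: multiplicities \<open>a g\<close>, where
    \<open>nat\<close> loses nothing because \<open>a\<close> is nonnegative.\<close>
  define S where "S = Abs_multiset (\<lambda>g. nat (a g))"
  have count: "count S g = nat (a g)" for g
    unfolding S_def by simp
  have "real (size S) = (\<Sum>g\<in>UNIV. real m * x $ g)"
    by (simp add: size_eq_sum_count_UNIV count nonneg flip: ax)
  also have "\<dots> = real m"
    using x by (simp add: std_simplex_def flip: sum_distrib_left)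
  finally have "size S = m" by simp
  moreover have "sum_mset S = 0"
    using zero by (simp add: sum_mset_eq_sum_zsmult count nonneg)
  moreover have "set_mset S = vec_supp x"
  proof -
    have "g \<in># S \<longleftrightarrow> 0 < x $ g" for g
    proof -
      have "g \<in># S \<longleftrightarrow> 0 < real_of_int (a g)"
        using count[of g] by (simp flip: count_greater_zero_iff)
      then show ?thesis unfolding ax using assms by (simp add: zero_less_mult_iff)
    qed
    then show ?thesis by (auto simp: vec_supp_def)
  qed
  moreover have "y = multiplicity_vec S"
    by (simp add: a multiplicity_vec_def vec_eq_iff count nonneg)
  ultimately show "y \<in> multiplicity_vec ` {S \<in> zero_sum_seqs m. set_mset S \<in> \<C>}"
    using x by (auto simp: zero_sum_seqs_def)
qed

lemma card_zero_sum_seqs_supp: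
  assumes "0 < m"
  shows "card {S \<in> zero_sum_seqs m. set_mset S \<in> \<C>}
       = card (dilate m {x \<in> std_simplex. vec_supp x \<in> \<C>} \<inter> relation_lattice)"
  unfolding multiplicity_vec_image[OF assms, symmetric]
  by (rule card_image[symmetric]) (rule inj_on_subset[OF inj_multiplicity_vec subset_UNIV])

section \<open>Faces of the simplex as convex hulls of unit vectors\<close>

lemma sum_scaleR_axis_nth:
  "(\<Sum>h\<in>A. u h *\<^sub>R (axis h 1 :: real ^ 'g::finite)) $ g = (if g \<in> A then u g else 0)"
  by (simp add: axis_def if_distrib cong: if_cong)

lemma inj_axis_one: "inj (\<lambda>g. axis g 1 :: real ^ 'g::finite)"
  by (auto simp: inj_def axis_eq_axis)

lemma independent_axes: "independent ((\<lambda>g. axis g 1 :: real ^ 'g::finite) ` A)"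
  by (rule independent_mono[OF independent_Basis]) (auto simp: axis_in_Basis_iff)


text \<open>The weights of a combination of unit vectors are its coordinates. The predicate
  \<open>P\<close> is left open so that \<ge> 0 yields the convex hull and > 0 its relative
  interior.\<close>

lemma convex_combination_axes_iff:
  fixes y :: "real ^ 'g::finite" and A :: "'g set"
  defines "E \<equiv> (\<lambda>g. axis g 1 :: real ^ 'g) ` A"
  shows "(\<exists>v. (\<forall>x\<in>E. P (v x)) \<and> sum v E = 1 \<and> (\<Sum>x\<in>E. v x *\<^sub>R x) = y)
    \<longleftrightarrow> (\<forall>g\<in>A. P (y $ g)) \<and> (\<forall>g. g \<notin> A \<longrightarrow> y $ g = 0) \<and> (\<Sum>g\<in>UNIV. y $ g) = 1"
    (is "?L \<longleftrightarrow> ?R")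
proof -
  let ?e = "\<lambda>g. axis g 1 :: real ^ 'g"
  have inj: "inj_on ?e A" by (rule inj_on_subset[OF inj_axis_one subset_UNIV])
  show ?thesis
  proof
    assume ?L
    then obtain v where v: "\<forall>g\<in>A. P (v (?e g))" "(\<Sum>g\<in>A. v (?e g)) = 1"
      and y: "y = (\<Sum>g\<in>A. v (?e g) *\<^sub>R ?e g)"
      by (auto simp: E_def sum.reindex[OF inj])
    have nth: "y $ g = (if g \<in> A then v (?e g) else 0)" for g
      unfolding y by (rule sum_scaleR_axis_nth)
    with v show ?R by (simp add: sum.If_cases)
  next
    assume R: ?R
    \<comment> \<open>Weights are functions of the vertex, not of its index; the inner product with
      \<open>axis g 1\<close> recovers the coordinate \<open>y $ g\<close>.\<close>
    let ?v = "\<lambda>x. y \<bullet> x"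
    have "(\<Sum>g\<in>A. y $ g) = (\<Sum>g\<in>UNIV. y $ g)"
      using R by (intro sum.mono_neutral_left) auto
    with R have "sum ?v E = 1" by (simp add: E_def sum.reindex[OF inj] inner_axis)
    moreover have "(\<Sum>x\<in>E. ?v x *\<^sub>R x) = (\<Sum>g\<in>A. y $ g *\<^sub>R ?e g)"
      by (simp add: E_def sum.reindex[OF inj] inner_axis)
    then have "(\<Sum>x\<in>E. ?v x *\<^sub>R x) = y"
      using R by (simp add: vec_eq_iff sum_scaleR_axis_nth del: sum_component)
    moreover have "\<forall>x\<in>E. P (?v x)" using R by (simp add: E_def inner_axis)
    ultimately show ?L by blast
  qed
qed

lemma simplex_face_eq_convex_hull:
  "simplex_face A = convex hull ((\<lambda>g. axis g 1 :: real ^ 'g::finite) ` A)"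
proof -
  \<comment> \<open>Outside \<open>A\<close> a coordinate is nonnegative but not positive, hence
    zero.\<close>
  have "(\<forall>g. 0 \<le> y $ g) \<and> {g. 0 < y $ g} \<subseteq> A
      \<longleftrightarrow> (\<forall>g\<in>A. 0 \<le> y $ g) \<and> (\<forall>g. g \<notin> A \<longrightarrow> y $ g = 0)" for y :: "real ^ 'g"
    unfolding subset_iff mem_Collect_eq by (metis order.order_iff_strict order.strict_iff_not)
  then show ?thesis
    unfolding convex_hull_finite[OF finite_imageI[OF finite]] convex_combination_axes_iff
      simplex_face_def std_simplex_def vec_supp_def
    by blast
qed

lemma affine_independent_axes:
  "\<not> affine_dependent ((\<lambda>g. axis g 1 :: real ^ 'g::finite) ` A)"
  using affine_dependent_imp_dependent independent_axes by blast

text \<open>For affinely independent vertices, the relative interior of the hull consists of the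
  combinations with all weights positive, which here means support exactly \<open>A\<close>.\<close>

lemma rel_interior_simplex_face: "rel_interior (simplex_face A) = open_simplex_face A"
proof -
  have "(\<forall>g. 0 \<le> y $ g) \<and> {g. 0 < y $ g} = A
      \<longleftrightarrow> (\<forall>g\<in>A. 0 < y $ g) \<and> (\<forall>g. g \<notin> A \<longrightarrow> y $ g = 0)" for y :: "real ^ 'a"
    unfolding set_eq_iff mem_Collect_eq by (metis order.order_iff_strict order.strict_iff_not)
  then show ?thesis
    unfolding simplex_face_eq_convex_hull
      rel_interior_convex_hull_explicit[OF affine_independent_axes] convex_combination_axes_iff
      open_simplex_face_def std_simplex_def vec_supp_def
    by blast
qed

lemma simplex_face_UNIV: "simplex_face UNIV = std_simplex"
  by (simp add: simplex_face_def)

text \<open>The faces of the hull of an affinely independent set are the hulls of its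
  subsets.\<close>

lemma simplex_face_face_of: "simplex_face A face_of std_simplex"
  unfolding simplex_face_UNIV[symmetric] simplex_face_eq_convex_hull
  by (rule face_of_convex_hull_affine_independent[OF affine_independent_axes, THEN iffD2])
     (intro exI[of _ "(\<lambda>g. axis g 1) ` A"] conjI refl image_mono subset_UNIV)

lemma aff_dim_simplex_face: "aff_dim (simplex_face A) = int (card A) - 1"
proof -
  have "card ((\<lambda>g. axis g 1 :: real ^ 'a) ` A) = card A"
    by (rule card_image) (rule inj_on_subset[OF inj_axis_one subset_UNIV])
  then show ?thesis
    using aff_dim_affine_independent[OF affine_independent_axes, of A]
    by (simp add: simplex_face_eq_convex_hull aff_dim_convex_hull)
qed

section \<open>Injectivity of \<open>T\<close> and transport of lattice points\<close>

text \<open>A linear right inverse \<open>g\<close> of \<open>f\<close> is injective, hence onto by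
  equality of dimensions. So every argument of \<open>f\<close> has the form \<open>g y\<close>, and
  \<open>f (g y) = y\<close> recovers \<open>y\<close>.\<close>

lemma linear_surj_imp_inj_eq_dim:
  fixes f :: "'a::euclidean_space \<Rightarrow> 'b::euclidean_space"
  assumes "linear f" "surj f" "DIM('a) = DIM('b)"
  shows "inj f"
proof -
  obtain g where g: "linear g" "f \<circ> g = id"
    using linear_surjective_right_inverse[OF assms(1,2)] by blast
  then have fg: "f (g y) = y" for y by (metis comp_apply id_apply)
  then have "inj g" by (metis injI)
  then have "dim (range g) = DIM('a)"
    using g assms(3) by (simp add: dim_image_eq)
  moreover have "subspace (range g)" using g by (simp add: linear_subspace_image)
  ultimately have "range g = UNIV" by (metis dim_eq_full span_eq_iff)
  then show ?thesis using fg by (metis injI surjD)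
qed

context
  fixes b :: "'n::finite \<Rightarrow> real ^ 'g::{finite,ab_group_add}"
    and T :: "real ^ 'g::{finite,ab_group_add} \<Rightarrow> real ^ 'n"
  assumes card_eq: "CARD('n) = CARD('g)"
    and basis: "is_Z_basis b relation_lattice"
    and linear: "linear T"
    and T_basis: "\<And>i. T (b i) = axis i 1"
begin

lemma T_combination: "T (\<Sum>i\<in>UNIV. c i *\<^sub>R b i) = (\<chi> i. c i)"
proof -
  have "T (\<Sum>i\<in>UNIV. c i *\<^sub>R b i) = (\<Sum>i\<in>UNIV. c i *\<^sub>R axis i 1)"
    by (simp add: linear_sum[OF linear] linear_scale[OF linear] T_basis)
  also have "\<dots> = (\<chi> i. c i)"
    by (simp add: vec_eq_iff sum_scaleR_axis_nth del: sum_component)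
  finally show ?thesis .
qed

lemma inj_T: "inj T"
proof -
  \<comment> \<open>An explicit preimage of \<open>y\<close>: its coordinates used as coefficients
    of the basis \<open>b\<close>.\<close>
  have "y = T (\<Sum>i\<in>UNIV. y $ i *\<^sub>R b i)" for y
    unfolding T_combination by simp
  then have "surj T" by (rule surjI[OF sym])
  then show ?thesis
    by (rule linear_surj_imp_inj_eq_dim[OF linear]) (simp add: card_eq)
qed

text \<open>The coordinates of \<open>T x\<close> are the coefficients of \<open>x\<close> in
  \<open>b\<close>. If they are integers, the corresponding combination of \<open>b\<close> lies in
  the lattice and has the same image as \<open>x\<close>, so it equals \<open>x\<close> by
  injectivity.\<close>

lemma T_mem_integer_points_iff: "T x \<in> integer_points \<longleftrightarrow> x \<in> relation_lattice"
proof
  assume "T x \<in> integer_points"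
  then have "\<forall>i. \<exists>k. T x $ i = of_int k"
    by (auto simp: integer_points_def elim: Ints_cases)
  then obtain k where "\<And>i. T x $ i = of_int (k i)" by metis
  then have "T x = T (\<Sum>i\<in>UNIV. of_int (k i) *\<^sub>R b i)"
    unfolding T_combination by (simp add: vec_eq_iff)
  then have "x = (\<Sum>i\<in>UNIV. of_int (k i) *\<^sub>R b i)" by (rule injD[OF inj_T])
  moreover have "b i \<in> relation_lattice" for i
    using basis by (auto simp: is_Z_basis_def)
  ultimately show "x \<in> relation_lattice"
    by (auto intro: sum_mem_relation_lattice scaleR_of_int_mem_relation_lattice)
next
  assume "x \<in> relation_lattice"
  then obtain c :: "'n \<Rightarrow> int" where "x = (\<Sum>i\<in>UNIV. of_int (c i) *\<^sub>R b i)"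
    using basis by (auto simp: is_Z_basis_def)
  then have "T x = (\<chi> i. of_int (c i))" by (simp only: T_combination)
  then show "T x \<in> integer_points" by (simp add: integer_points_def)
qed

text \<open>\<open>T\<close> commutes with dilation and matches lattice points with integer points.
  As \<open>X\<close> is arbitrary, this covers both the closed polytope and the relative interiors
  of its faces.\<close>

lemma card_dilate_image:
  "card (dilate m (T ` X) \<inter> integer_points) = card (dilate m X \<inter> relation_lattice)"
proof -
  have "dilate m (T ` X) = T ` dilate m X"
    by (simp add: dilate_def image_image linear_scale[OF linear])
  then have "dilate m (T ` X) \<inter> integer_points = T ` (dilate m X \<inter> relation_lattice)"
    by (auto simp: T_mem_integer_points_iff)
  then show ?thesis
    by (simp add: card_image inj_on_subset[OF inj_T subset_UNIV])
qed

lemma rel_interior_image_simplex_face: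
  "rel_interior (T ` simplex_face A) = T ` open_simplex_face A"
  by (simp add: rel_interior_injective_linear_image linear_linear linear inj_T
      rel_interior_simplex_face flip: linear_conv_bounded_linear)

end

theorem proposition2p3:
  fixes b :: "'n::finite \<Rightarrow> real ^ 'g::{finite,ab_group_add}"
    and T :: "real ^ 'g::{finite,ab_group_add} \<Rightarrow> real ^ 'n"
  assumes "CARD('n) = CARD('g)"
    and "is_Z_basis b relation_lattice"
    and "linear T"
    and "\<And>i. T (b i) = axis i 1"
  shows "(\<forall>m>0. card (zero_sum_seqs m :: 'g multiset set)
                 = card (dilate m (T ` std_simplex) \<inter> integer_points))
    \<and> (\<forall>A. A \<noteq> {} \<longrightarrow>
          T ` simplex_face A face_of (T ` std_simplex)
        \<and> aff_dim (T ` simplex_face A) = int (card A) - 1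
        \<and> (\<forall>m>0.
              card (dilate m (rel_interior (T ` simplex_face A)) \<inter> integer_points)
                = card (dilate m (open_simplex_face A) \<inter> relation_lattice)
            \<and> card (dilate m (open_simplex_face A) \<inter> relation_lattice)
                = card {S \<in> zero_sum_seqs m. set_mset S = A}))
    \<and> (\<forall>m>0. card (dilate m (rel_interior (T ` std_simplex)) \<inter> integer_points)
                 = card {S \<in> zero_sum_seqs m. set_mset S = (UNIV :: 'g set)})"
proof (intro conjI allI impI)
  note hyps = assms
  \<comment> \<open>The choice of the singleton \<open>{A}\<close> for \<C> turns membership of the
    support into equality with \<open>A\<close>.\<close>
  have open_face: "{x \<in> std_simplex. vec_supp x \<in> {A}} = open_simplex_face A" for A :: "'g set"
    by (simp add: open_simplex_face_def)
  have open_count: "card (dilate m (open_simplex_face A) \<inter> relation_lattice)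
      = card {S \<in> zero_sum_seqs m. set_mset S = A}" if "0 < m" for m and A :: "'g set"
    using card_zero_sum_seqs_supp[OF that, of "{A}"] unfolding open_face by simp
  have image_count: "card (dilate m (rel_interior (T ` simplex_face A)) \<inter> integer_points)
      = card (dilate m (open_simplex_face A) \<inter> relation_lattice)" for m A
    unfolding rel_interior_image_simplex_face[OF hyps] by (rule card_dilate_image[OF hyps])
  {
    fix m :: nat assume "0 < m"
    then show "card (zero_sum_seqs m :: 'g multiset set)
        = card (dilate m (T ` std_simplex) \<inter> integer_points)"
      using card_zero_sum_seqs_supp[of m "UNIV :: 'g set set"]
      by (simp add: card_dilate_image[OF hyps])
    \<comment> \<open>The whole polytope is the face belonging to \<open>A = UNIV\<close>, so this
      is the case of full support.\<close>
    show "card (dilate m (rel_interior (T ` std_simplex)) \<inter> integer_points)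
        = card {S \<in> zero_sum_seqs m. set_mset S = (UNIV :: 'g set)}"
      using image_count[of m UNIV] open_count[OF \<open>0 < m\<close>, of UNIV]
      by (simp add: simplex_face_UNIV)
  next
    fix A :: "'g set" assume "A \<noteq> {}"
    show "T ` simplex_face A face_of (T ` std_simplex)"
      by (simp add: face_of_linear_image \<open>linear T\<close> inj_T[OF hyps] simplex_face_face_of)
    show "aff_dim (T ` simplex_face A) = int (card A) - 1"
      by (simp add: aff_dim_injective_linear_image \<open>linear T\<close> inj_T[OF hyps] aff_dim_simplex_face)
    fix m :: nat assume "0 < m"
    then show "card (dilate m (open_simplex_face A) \<inter> relation_lattice)
        = card {S \<in> zero_sum_seqs m. set_mset S = A}"
      by (rule open_count)
    show "card (dilate m (rel_interior (T ` simplex_face A)) \<inter> integer_points)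
        = card (dilate m (open_simplex_face A) \<inter> relation_lattice)"
      by (rule image_count)
  }
qed

end
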